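(* Let $\mathbf{G}(s)=\mathbf{B}^T\mathbf{Q}(s\mathbf{I}-(\mathbf{J}-\mathbf{R})\mathbf{Q})^{-1}\mathbf{B}$ be a port-Hamiltonian system, i.e. $\mathbf{J},\mathbf{R},\mathbf{Q}\in\mathbb{R}^{n\times n}$, $\mathbf{B}\in\mathbb{R}^{n\times m}$, $\mathbf{J}=-\mathbf{J}^T$, $\mathbf{R}=\mathbf{R}^T\ge0$, $\mathbf{Q}=\mathbf{Q}^T>0$, and assume $\mathbf{G}(s)$ is asymptotically stable (all eigenvalues of $(\mathbf{J}-\mathbf{R})\mathbf{Q}$ have negative real part). Suppose the iteration IRKA-PH converges to a reduced model of order $r$, $$\mathbf{G}_r(s)=\sum_{i=1}^r\frac{1}{s-\hat\lambda_i}\,\mathbf{c}_i\mathbf{b}_i^T .$$ Then $\mathbf{G}_r(s)$ is port-Hamiltonian, asymptotically stable, and passive. Moreover, $\mathbf{G}_r(s)$ satisfies the following first-order necessary condition for $\mathcal{H}_2$ optimality: $\mathbf{G}_r(s)$ interpolates $\mathbf{G}(s)$ at $-\hat\lambda_i$ along the tangent direction $\mathbf{b}_i$, that is, $$\mathbf{G}(-\hat\lambda_i)\mathbf{b}_i=\mathbf{G}_r(-\hat\lambda_i)\mathbf{b}_i\qquad\text{for } i=1,\dots,r.$$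
   Context: A port-Hamiltonian system is a real system $\dot{\mathbf{x}}=(\mathbf{J}-\mathbf{R})\mathbf{Q}\mathbf{x}+\mathbf{B}\mathbf{u}$, $\mathbf{y}=\mathbf{B}^T\mathbf{Q}\mathbf{x}$ with $\mathbf{J}$ skew-symmetric, $\mathbf{R}$ symmetric positive semidefinite and $\mathbf{Q}$ symmetric positive definite; a system and its transfer function are denoted by the same symbol. It is asymptotically stable if all eigenvalues of its state matrix $(\mathbf{J}-\mathbf{R})\mathbf{Q}$ lie in the open left half-plane. It is passive if along trajectories $\frac{d}{dt}\frac12\mathbf{x}^T\mathbf{Q}\mathbf{x}\le\mathbf{u}^T\mathbf{y}$. The iteration IRKA-PH. The data are points $s_1,\dots,s_r\in\mathbb{C}$ and directions $\mathbf{b}_1,\dots,\mathbf{b}_r\in\mathbb{C}^m$, closed under conjugation. From the current data one forms a reduced model as follows: (i) $\mathbf{V}_r=\big[(s_1\mathbf{I}-(\mathbf{J}-\mathbf{R})\mathbf{Q})^{-1}\mathbf{B}\mathbf{b}_1,\ldots,(s_r\mathbf{I}-(\mathbf{J}-\mathbf{R})\mathbf{Q})^{-1}\mathbf{B}\mathbf{b}_r\big]\in\mathbb{C}^{n\times r}$ (the inverses are assumed to exist and $\mathbf{V}_r$ to have full column rank); (ii) choose a nonsingular $\mathbf{M}\in\mathbb{C}^{r\times r}$ with $\widehat{\mathbf{V}}_r=\mathbf{V}_r\mathbf{M}$ real and set $\widehat{\mathbf{W}}_r=\mathbf{Q}\widehat{\mathbf{V}}_r(\widehat{\mathbf{V}}_r^T\mathbf{Q}\widehat{\mathbf{V}}_r)^{-1}$;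 (iii) $\mathbf{J}_r=\widehat{\mathbf{W}}_r^T\mathbf{J}\widehat{\mathbf{W}}_r$, $\mathbf{R}_r=\widehat{\mathbf{W}}_r^T\mathbf{R}\widehat{\mathbf{W}}_r$, $\mathbf{Q}_r=\widehat{\mathbf{V}}_r^T\mathbf{Q}\widehat{\mathbf{V}}_r$, $\mathbf{B}_r=\widehat{\mathbf{W}}_r^T\mathbf{B}$, $\mathbf{A}_r=(\mathbf{J}_r-\mathbf{R}_r)\mathbf{Q}_r$, $\mathbf{C}_r=\mathbf{B}_r^T\mathbf{Q}_r$, giving the reduced model $\mathbf{G}_r(s)=\mathbf{C}_r(s\mathbf{I}_r-\mathbf{A}_r)^{-1}\mathbf{B}_r$. The data are then updated: compute eigenvalues $\hat\lambda_i$ of $\mathbf{A}_r$ with right and left eigenvectors, $\mathbf{A}_r\mathbf{x}_i=\hat\lambda_i\mathbf{x}_i$, $\mathbf{y}_i^*\mathbf{A}_r=\hat\lambda_i\mathbf{y}_i^*$, normalized by $\mathbf{y}_i^*\mathbf{x}_j=\delta_{ij}$ for $i,j=1,\dots,r$ (so $\mathbf{A}_r$ is diagonalizable), and set $s_i\leftarrow-\hat\lambda_i$, $\mathbf{b}_i^T\leftarrow\mathbf{y}_i^*\mathbf{B}_r$. These steps are repeated until convergence. "IRKA-PH converges to $\mathbf{G}_r$" means that the final data are a fixed point of this update: the reduced model $\mathbf{G}_r$ built by (i)-(iii) from $(s_i,\mathbf{b}_i)_{i=1}^r$ satisfies $s_i=-\hat\lambda_i$ and $\mathbf{b}_i^T=\mathbf{y}_i^*\mathbf{B}_r$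 for all $i=1,\dots,r$, where $\hat\lambda_1,\dots,\hat\lambda_r$ are the eigenvalues of $\mathbf{A}_r$ and $\mathbf{x}_i,\mathbf{y}_i$ are right and left eigenvectors with $\mathbf{A}_r\mathbf{x}_i=\hat\lambda_i\mathbf{x}_i$, $\mathbf{y}_i^*\mathbf{A}_r=\hat\lambda_i\mathbf{y}_i^*$ and $\mathbf{y}_i^*\mathbf{x}_j=\delta_{ij}$ for $i,j=1,\dots,r$. Then $\mathbf{G}_r(s)=\sum_{i=1}^r\frac{1}{s-\hat\lambda_i}\mathbf{c}_i\mathbf{b}_i^T$ with $\mathbf{c}_i=\mathbf{C}_r\mathbf{x}_i$. *)

theory Defs
  imports "HOL-Analysis.Analysis"
begin

abbreviation cmat :: "real^'a^'b \<Rightarrow> complex^'a^'b"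
  where "cmat \<equiv> map_matrix complex_of_real"

definition cnj_vec :: "complex^'a \<Rightarrow> complex^'a"
  where "cnj_vec v = (\<chi> k. cnj (v $ k))"

definition eigenvalue :: "complex^'a^'a \<Rightarrow> complex \<Rightarrow> bool"
  where "eigenvalue A \<mu> \<longleftrightarrow> (\<exists>v. v \<noteq> 0 \<and> A *v v = \<mu> *s v)"

text \<open>
  Coefficients of a system \<open>x' = (J - R) Q x + B u\<close>, \<open>y = B\<^sup>T Q x\<close> with state space
  \<open>real ^ 'n\<close> and input/output space \<open>real ^ 'm\<close>. The record carries no structural
  constraints; these are the predicate \<open>port_hamiltonian\<close> below.
\<close>

record ('n, 'm) sys =
  Jmat :: "real^'n^'n"
  Rmat :: "real^'n^'n"
  Qmat :: "real^'n^'n"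
  Bmat :: "real^'m^'n"

definition Amat :: "('n::finite, 'm::finite) sys \<Rightarrow> real^'n^'n"
  where "Amat G = (Jmat G - Rmat G) ** Qmat G"

definition Cmat :: "('n::finite, 'm::finite) sys \<Rightarrow> real^'n^'m"
  where "Cmat G = transpose (Bmat G) ** Qmat G"

definition port_hamiltonian :: "('n::finite, 'm::finite) sys \<Rightarrow> bool"
  where "port_hamiltonian G \<longleftrightarrow>
    transpose (Jmat G) = - Jmat G \<and>
    transpose (Rmat G) = Rmat G \<and> (\<forall>v. 0 \<le> v \<bullet> (Rmat G *v v)) \<and>
    transpose (Qmat G) = Qmat G \<and> (\<forall>v. v \<noteq> 0 \<longrightarrow> 0 < v \<bullet> (Qmat G *v v))"

definition asymptotically_stable :: "('n::finite, 'm::finite) sys \<Rightarrow> bool"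
  where "asymptotically_stable G \<longleftrightarrow> (\<forall>\<mu>. eigenvalue (cmat (Amat G)) \<mu> \<longrightarrow> Re \<mu> < 0)"

definition trajectory ::
    "('n::finite, 'm::finite) sys \<Rightarrow> real set \<Rightarrow> (real \<Rightarrow> real^'m) \<Rightarrow> (real \<Rightarrow> real^'n) \<Rightarrow> bool"
  where "trajectory G T u x \<longleftrightarrow>
    (\<forall>t\<in>T. (x has_vector_derivative (Amat G *v x t + Bmat G *v u t)) (at t within T))"

text \<open>
  Passivity with respect to the storage function \<open>x\<^sup>T Q x / 2\<close>, along all trajectories on
  nondegenerate time intervals.
\<close>

definition is_passive :: "('n::finite, 'm::finite) sys \<Rightarrow> bool"
  where "is_passive G \<longleftrightarrow>
    (\<forall>T u x. is_interval T \<and> interior T \<noteq> {} \<and> trajectory G T u x \<longrightarrow>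
      (\<forall>t\<in>T. \<exists>d.
        ((\<lambda>\<tau>. 1/2 * (x \<tau> \<bullet> (Qmat G *v x \<tau>))) has_real_derivative d) (at t within T) \<and>
        d \<le> u t \<bullet> (Cmat G *v x t)))"

text \<open>
  Meaningful only where \<open>z\<close> is not an eigenvalue of the state matrix, as \<open>matrix_inv\<close> is total.
\<close>

definition transfer :: "('n::finite, 'm::finite) sys \<Rightarrow> complex \<Rightarrow> complex^'m^'m"
  where "transfer G z = cmat (Cmat G) ** matrix_inv (mat z - cmat (Amat G)) ** cmat (Bmat G)"

definition conj_closed :: "('r \<Rightarrow> complex) \<Rightarrow> ('r \<Rightarrow> complex^'m) \<Rightarrow> bool"
  where "conj_closed s b \<longleftrightarrow> (\<forall>i. \<exists>j. s j = cnj (s i) \<and> b j = cnj_vec (b i))"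

text \<open>The \<open>i\<close>-th column is \<open>(s\<^sub>i I - A)\<^sup>-\<^sup>1 B b\<^sub>i\<close>.\<close>

definition krylov_basis ::
    "('n::finite, 'm::finite) sys \<Rightarrow> ('r \<Rightarrow> complex) \<Rightarrow> ('r \<Rightarrow> complex^'m) \<Rightarrow> complex^'r^'n"
  where "krylov_basis G s b =
    (\<chi> k i. (matrix_inv (mat (s i) - cmat (Amat G)) *v (cmat (Bmat G) *v b i)) $ k)"

definition what :: "('n::finite, 'm::finite) sys \<Rightarrow> real^'r^'n \<Rightarrow> real^'r^'n"
  where "what G V = Qmat G ** V ** matrix_inv (transpose V ** Qmat G ** V)"

definition reduce :: "('n::finite, 'm::finite) sys \<Rightarrow> real^'r^'n \<Rightarrow> ('r::finite, 'm) sys"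
  where "reduce G V =
    \<lparr> Jmat = transpose (what G V) ** Jmat G ** what G V,
      Rmat = transpose (what G V) ** Rmat G ** what G V,
      Qmat = transpose V ** Qmat G ** V,
      Bmat = transpose (what G V) ** Bmat G \<rparr>"

definition reduced_model ::
    "('n::finite, 'm::finite) sys \<Rightarrow> ('r::finite \<Rightarrow> complex) \<Rightarrow> ('r \<Rightarrow> complex^'m) \<Rightarrow> ('r, 'm) sys \<Rightarrow> bool"
  where "reduced_model G s b Gr \<longleftrightarrow>
    conj_closed s b \<and>
    (\<forall>i. invertible (mat (s i) - cmat (Amat G))) \<and>
    rank (krylov_basis G s b) = CARD('r) \<and>
    (\<exists>(M :: complex^'r^'r) (V :: real^'r^'n).
      invertible M \<and> cmat V = krylov_basis G s b ** M \<and> Gr = reduce G V)"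

text \<open>Right and left eigenvectors of \<open>A\<close>, normalized by \<open>y\<^sub>i\<^sup>* x\<^sub>j = \<delta>\<^sub>i\<^sub>j\<close>.\<close>

definition eigensystem ::
    "complex^'r^'r \<Rightarrow> ('r \<Rightarrow> complex) \<Rightarrow> ('r \<Rightarrow> complex^'r) \<Rightarrow> ('r \<Rightarrow> complex^'r) \<Rightarrow> bool"
  where "eigensystem A lam x y \<longleftrightarrow>
    (\<forall>i. A *v x i = lam i *s x i) \<and>
    (\<forall>i. cnj_vec (y i) v* A = lam i *s cnj_vec (y i)) \<and>
    (\<forall>i j. scalar_product (cnj_vec (y i)) (x j) = (if i = j then 1 else 0))"

text \<open>
  One step of the iteration takes the data \<open>(s, b)\<close> to \<open>(s', b')\<close>. It is a relation, since the
  real basis of the projection space and the eigenvectors are not determined by \<open>(s, b)\<close>.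
\<close>

definition irka_ph_step ::
    "('n::finite, 'm::finite) sys \<Rightarrow> ('r::finite \<Rightarrow> complex) \<Rightarrow> ('r \<Rightarrow> complex^'m) \<Rightarrow>
     ('r, 'm) sys \<Rightarrow> ('r \<Rightarrow> complex) \<Rightarrow> ('r \<Rightarrow> complex^'r) \<Rightarrow> ('r \<Rightarrow> complex^'r) \<Rightarrow>
     ('r \<Rightarrow> complex) \<Rightarrow> ('r \<Rightarrow> complex^'m) \<Rightarrow> bool"
  where "irka_ph_step G s b Gr lam x y s' b' \<longleftrightarrow>
    reduced_model G s b Gr \<and>
    eigensystem (cmat (Amat Gr)) lam x y \<and>
    (\<forall>i. s' i = - lam i) \<and>
    (\<forall>i. b' i = cnj_vec (y i) v* cmat (Bmat Gr))"

definition irka_ph_converges ::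
    "('n::finite, 'm::finite) sys \<Rightarrow> ('r::finite \<Rightarrow> complex) \<Rightarrow> ('r \<Rightarrow> complex^'m) \<Rightarrow>
     ('r, 'm) sys \<Rightarrow> ('r \<Rightarrow> complex) \<Rightarrow> ('r \<Rightarrow> complex^'r) \<Rightarrow> ('r \<Rightarrow> complex^'r) \<Rightarrow> bool"
  where "irka_ph_converges G s b Gr lam x y \<longleftrightarrow> irka_ph_step G s b Gr lam x y s b"

end

theory Submission
  imports Defs
begin

text \<open>
  The reduction is a Petrov-Galerkin projection with \<open>W\<^sup>T V = I\<close>, \<open>A\<^sub>r = W\<^sup>T A V\<close> and \<open>C\<^sub>r = C V\<close>, and
  \<open>(s\<^sub>i I - A)\<^sup>-\<^sup>1 B b\<^sub>i\<close> lies in the range of \<open>V\<close>, so interpolation at \<open>s\<^sub>i = -\<lambda>\<^sub>i\<close> holds as soon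
  as \<open>s\<^sub>i\<close> is not a pole of the reduced model; this follows from asymptotic stability.

  The port-Hamiltonian structure only gives \<open>Re \<lambda>\<^sub>i \<le> 0\<close>. Suppose \<open>Re \<lambda>\<^sub>i = 0\<close>. By closure under
  conjugation there is \<open>k\<close> with \<open>\<lambda>\<^sub>k = cnj \<lambda>\<^sub>i = s\<^sub>i\<close> and \<open>b\<^sub>k = cnj b\<^sub>i\<close>. Projecting
  \<open>(s\<^sub>i I - A) V \<xi> = B b\<^sub>i\<close> gives \<open>(s\<^sub>i I - A\<^sub>r) \<xi> = B\<^sub>r b\<^sub>i\<close>, and multiplying by the left eigenvector
  \<open>y\<^sub>k\<^sup>*\<close> gives \<open>0 = b\<^sub>k\<^sup>T b\<^sub>i = |b\<^sub>i|\<^sup>2\<close>. Then the \<open>i\<close>-th column of the Krylov basis vanishes,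
  contradicting its full rank.
\<close>

section \<open>Matrices\<close>

lemma matrix_inv_right:
  fixes A :: "'a::field^'n^'n"
  assumes "invertible A"
  shows "A ** matrix_inv A = mat 1"
  using someI_ex[of "\<lambda>B. A ** B = mat 1 \<and> B ** A = mat 1"] assms
  unfolding invertible_def matrix_inv_def by blast

lemma matrix_inv_left:
  fixes A :: "'a::field^'n^'n"
  assumes "invertible A"
  shows "matrix_inv A ** A = mat 1"
  using matrix_inv_right[OF assms] matrix_left_right_inverse by blast

lemma matrix_inv_unique:
  fixes A B :: "'a::field^'n^'n"
  assumes "A ** B = mat 1"
  shows "matrix_inv A = B"
proof -
  have "invertible A"
    using assms invertible_right_inverse by blast
  then have "matrix_inv A ** (A ** B) = B"
    by (simp add: matrix_mul_assoc matrix_inv_left)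
  then show ?thesis
    by (simp add: assms)
qed

lemma transpose_matrix_inv_symmetric:
  fixes A :: "'a::field^'n^'n"
  assumes "invertible A" "transpose A = A"
  shows "transpose (matrix_inv A) = matrix_inv A"
proof -
  have "A ** transpose (matrix_inv A) = transpose (matrix_inv A ** A)"
    by (simp add: matrix_transpose_mul assms(2))
  then have "A ** transpose (matrix_inv A) = mat 1"
    by (simp add: matrix_inv_left assms(1))
  then show ?thesis
    by (rule matrix_inv_unique[symmetric])
qed

lemma invertible_of_ker:
  fixes A :: "'a::field^'n^'n"
  assumes "\<And>v. A *v v = 0 \<Longrightarrow> v = 0"
  shows "invertible A"
  using assms matrix_left_invertible_ker invertible_left_inverse by metis

text \<open>\<open>rank\<close> is the dimension of the row span, so full column rank means that the
  rows span the whole space, which gives a left inverse.\<close>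

lemma full_column_rank_ker:
  fixes A :: "'a::field^'n^'m"
  assumes "rank A = CARD('n)" "A *v v = 0"
  shows "v = 0"
proof -
  have "vec.span (rows A) = UNIV"
    using assms(1) vec.dim_eq_full[of "rows A"]
    by (simp add: row_rank_def_gen vec.dimension_def card_cart_basis)
  then show ?thesis
    using assms(2) matrix_left_invertible_span_rows_gen matrix_left_invertible_ker by metis
qed

lemma mat_mult_vec: "mat c *v v = c *s (v :: 'a::field^'n)"
  by (vector matrix_vector_mult_def mat_def)
     (simp add: if_distrib if_distribR cong del: if_weak_cong)

lemma vec_mult_mat: "v v* mat c = c *s (v :: 'a::field^'n)"
  by (metis mat_mult_vec transpose_mat transpose_matrix_vector)

lemma matrix_vector_mult_sum:
  fixes A :: "'a::field^'n^'m"
  shows "A *v (\<Sum>i\<in>S. f i) = (\<Sum>i\<in>S. A *v f i)"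
  by (induction S rule: infinite_finite_induct) (auto simp: matrix_vector_right_distrib)

lemma matrix_vector_mult_axis: "A *v axis i 1 = column i (A :: 'a::comm_semiring_1^'n^'m)"
  by (simp add: matrix_mult_sum axis_def vec_eq_iff if_distrib if_distribR cong: if_cong)

text \<open>The pairing is bilinear, without conjugation, so a matrix can be moved onto a left
  eigenvector written as \<open>cnj_vec (y i)\<close>.\<close>

lemma scalar_product_matrix_vector:
  fixes A :: "'a::comm_semiring_1^'n^'m"
  shows "scalar_product u (A *v v) = scalar_product (u v* A) v"
  unfolding scalar_product_def matrix_vector_mult_def vector_matrix_mult_def
  by (simp add: sum_distrib_left sum_distrib_right mult_ac) (rule sum.swap)

lemma cmat_mult: "cmat (A ** B) = cmat A ** cmat B"
  by (simp add: vec_eq_iff matrix_matrix_mult_def)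

lemma cmat_mat_1: "cmat (mat 1) = mat 1"
  by (simp add: vec_eq_iff mat_def)

lemma Re_cmat_mult_vec: "(\<chi> k. Re ((cmat A *v v) $ k)) = A *v (\<chi> k. Re (v $ k))"
  by (simp add: vec_eq_iff matrix_vector_mult_def)

lemma Im_cmat_mult_vec: "(\<chi> k. Im ((cmat A *v v) $ k)) = A *v (\<chi> k. Im (v $ k))"
  by (simp add: vec_eq_iff matrix_vector_mult_def)

lemma scalar_product_cnj_vec_self_eq_0:
  assumes "scalar_product (cnj_vec v) v = 0"
  shows "v = 0"
proof -
  have "(\<Sum>k\<in>UNIV. (cmod (v $ k))\<^sup>2) = 0"
    using arg_cong[OF assms, of Re]
    by (simp add: scalar_product_def cnj_vec_def cmod_power2 flip: power2_eq_square)
  then show ?thesis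
    by (simp add: sum_nonneg_eq_0_iff vec_eq_iff)
qed

text \<open>A scalar equals its own transpose, here its own negative.\<close>

lemma inner_skew_symmetric:
  fixes A :: "real^'n^'n"
  assumes "transpose A = - A"
  shows "v \<bullet> (A *v v) = 0"
proof -
  have "v \<bullet> (A *v v) = (transpose A *v v) \<bullet> v"
    by (simp add: dot_lmul_matrix)
  also have "\<dots> = - (v \<bullet> (A *v v))"
    \<comment> \<open>Distributivity for \<open>0 - A\<close> supplies the rule for the negated
      matrix.\<close>
    using matrix_vector_mult_diff_rdistrib[of 0 A v] unfolding assms
    by (simp add: inner_commute)
  finally show ?thesis
    by simp
qed

lemma inner_symmetric_matrix:
  fixes A :: "real^'n^'n"
  assumes "transpose A = A"
  shows "u \<bullet> (A *v v) = v \<bullet> (A *v u)"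
  by (metis assms dot_lmul_matrix inner_commute transpose_matrix_vector)


section \<open>Port-Hamiltonian systems\<close>

text \<open>With \<open>q = Q v\<close>, symmetry of \<open>Q\<close> turns the form into
  \<open>q\<^sup>T (J - R) q\<close>; the skew part vanishes and \<open>R\<close> only
  dissipates.\<close>

lemma port_hamiltonian_dissipation:
  assumes "port_hamiltonian G"
  shows "v \<bullet> (Qmat G *v (Amat G *v v)) \<le> 0"
proof -
  note pH = assms[unfolded port_hamiltonian_def]
  let ?q = "Qmat G *v v"
  have "v \<bullet> (Qmat G *v (Amat G *v v)) = ?q \<bullet> (Amat G *v v)"
    using pH by (metis dot_lmul_matrix transpose_matrix_vector)
  also have "\<dots> = ?q \<bullet> (Jmat G *v ?q) - ?q \<bullet> (Rmat G *v ?q)"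
    by (simp add: Amat_def matrix_vector_mul_assoc[symmetric] matrix_vector_mult_diff_rdistrib
        inner_diff_right)
  also have "\<dots> \<le> 0"
    using pH by (simp add: inner_skew_symmetric)
  finally show ?thesis .
qed

text \<open>Lyapunov argument with the energy \<open>v\<^sup>* Q v > 0\<close>: splitting
  \<open>v\<close> into real and imaginary parts reduces it to the real dissipation
  inequality.\<close>

lemma port_hamiltonian_eigenvalue_Re_le_0:
  assumes "port_hamiltonian G" "cmat (Amat G) *v v = \<mu> *s v" "v \<noteq> 0"
  shows "Re \<mu> \<le> 0"
proof -
  note pH = assms(1)[unfolded port_hamiltonian_def]
  define a where "a = (\<chi> k. Re (v $ k))"
  define c where "c = (\<chi> k. Im (v $ k))"
  let ?E = "\<lambda>w. w \<bullet> (Qmat G *v w)"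
  have Aa: "Amat G *v a = Re \<mu> *\<^sub>R a - Im \<mu> *\<^sub>R c"
    using Re_cmat_mult_vec[of "Amat G" v] assms(2) by (simp add: a_def c_def vec_eq_iff)
  have Ac: "Amat G *v c = Im \<mu> *\<^sub>R a + Re \<mu> *\<^sub>R c"
    using Im_cmat_mult_vec[of "Amat G" v] assms(2) by (simp add: a_def c_def vec_eq_iff add.commute)
  \<comment> \<open>The cross terms carrying \<open>Im \<mu>\<close> cancel because \<open>Q\<close>
    is symmetric.\<close>
  have "Re \<mu> * (?E a + ?E c) = a \<bullet> (Qmat G *v (Amat G *v a)) + c \<bullet> (Qmat G *v (Amat G *v c))"
    using inner_symmetric_matrix[of "Qmat G" a c] pH unfolding Aa Ac
    by (simp add: algebra_simps)
  also have "\<dots> \<le> 0"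
    using port_hamiltonian_dissipation[OF assms(1)] by (meson add_nonpos_nonpos)
  finally have "Re \<mu> * (?E a + ?E c) \<le> 0" .
  moreover have "a \<noteq> 0 \<or> c \<noteq> 0"
    using assms(3) by (auto simp: a_def c_def vec_eq_iff complex_eq_iff)
  then have "0 < ?E a + ?E c"
    using pH by (metis add.left_neutral add.right_neutral add_pos_pos inner_zero_left)
  ultimately show ?thesis
    by (simp add: mult_le_0_iff)
qed

text \<open>Symmetry of \<open>Q\<close> merges the two product-rule terms. The part from
  \<open>A x\<close> is dissipated, and the part from \<open>B u\<close> is exactly the supplied
  power because \<open>C = B\<^sup>T Q\<close>.\<close>

lemma port_hamiltonian_is_passive:
  assumes "port_hamiltonian G"
  shows "is_passive G"
  unfolding is_passive_def
proof (intro allI impI ballI, elim conjE)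
  fix T u x t
  assume tr: "trajectory G T u x" and t: "t \<in> T"
  note pH = assms[unfolded port_hamiltonian_def]
  define x' where "x' = Amat G *v x t + Bmat G *v u t"
  have dx: "(x has_vector_derivative x') (at t within T)"
    using tr t by (simp add: trajectory_def x'_def)
  have "((\<lambda>\<tau>. x \<tau> \<bullet> (Qmat G *v x \<tau>)) has_vector_derivative
      x t \<bullet> (Qmat G *v x') + x' \<bullet> (Qmat G *v x t)) (at t within T)"
    using bounded_bilinear.has_vector_derivative[OF bounded_bilinear_inner dx
        bounded_linear.has_vector_derivative[OF matrix_vector_mul_bounded_linear dx]] .
  then have "((\<lambda>\<tau>. x \<tau> \<bullet> (Qmat G *v x \<tau>)) has_real_derivative
      2 * (x t \<bullet> (Qmat G *v x'))) (at t within T)"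
    using inner_symmetric_matrix[of "Qmat G" x' "x t"] pH
    by (simp add: has_real_derivative_iff_has_vector_derivative)
  then have D: "((\<lambda>\<tau>. 1/2 * (x \<tau> \<bullet> (Qmat G *v x \<tau>))) has_real_derivative
      x t \<bullet> (Qmat G *v x')) (at t within T)"
    using DERIV_cmult[of _ _ t T "1/2"] by fastforce
  have "x t \<bullet> (Qmat G *v (Bmat G *v u t)) = (Bmat G *v u t) \<bullet> (Qmat G *v x t)"
    using inner_symmetric_matrix pH by blast
  also have "\<dots> = u t \<bullet> (Cmat G *v x t)"
    by (metis Cmat_def dot_lmul_matrix matrix_vector_mul_assoc vector_transpose_matrix)
  finally have "x t \<bullet> (Qmat G *v x') \<le> u t \<bullet> (Cmat G *v x t)"
    using port_hamiltonian_dissipation[OF assms, of "x t"]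
    by (simp add: x'_def matrix_vector_right_distrib inner_add_right)
  with D show "\<exists>d. ((\<lambda>\<tau>. 1/2 * (x \<tau> \<bullet> (Qmat G *v x \<tau>))) has_real_derivative d) (at t within T) \<and>
      d \<le> u t \<bullet> (Cmat G *v x t)"
    by blast
qed


section \<open>Structure-preserving reduction\<close>

lemma inner_transpose_conjugation:
  fixes A :: "real^'n^'n" and V :: "real^'r^'n"
  shows "v \<bullet> ((transpose V ** A ** V) *v v) = (V *v v) \<bullet> (A *v (V *v v))"
  by (metis dot_lmul_matrix matrix_vector_mul_assoc vector_transpose_matrix)

text \<open>Structure preservation works for every injective real \<open>V\<close>; the Krylov
  choice of \<open>V\<close> enters only through the equation assumed in the projection and
  interpolation lemmas.\<close>

locale ph_reduction =
  fixes G :: "('n::finite, 'm::finite) sys" and V :: "real^'r::finite^'n"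
  assumes pH: "port_hamiltonian G"
    and V_ker: "\<And>v. V *v v = 0 \<Longrightarrow> v = 0"
begin

abbreviation "W \<equiv> what G V"
abbreviation "Hr \<equiv> reduce G V"

lemma reduce_Q_pos: "v \<noteq> 0 \<Longrightarrow> 0 < v \<bullet> (Qmat Hr *v v)"
  using pH V_ker[of v] unfolding port_hamiltonian_def
  by (auto simp: reduce_def inner_transpose_conjugation)

lemma reduce_Q_symmetric: "transpose (Qmat Hr) = Qmat Hr"
  using pH unfolding port_hamiltonian_def
  by (simp add: reduce_def matrix_transpose_mul matrix_mul_assoc)

text \<open>Positive definiteness excludes a kernel. This makes the total \<open>matrix_inv\<close>
  inside \<open>what\<close> a genuine inverse.\<close>

lemma reduce_Q_invertible: "invertible (Qmat Hr)"
  by (rule invertible_of_ker) (metis reduce_Q_pos inner_zero_right less_irrefl)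

text \<open>Congruence with \<open>W\<close> preserves skew-symmetry, symmetry and
  semidefiniteness.\<close>

lemma port_hamiltonian_reduce: "port_hamiltonian Hr"
proof -
  note pH' = pH[unfolded port_hamiltonian_def]
  have "transpose (Jmat Hr) = transpose W ** transpose (Jmat G) ** W"
    by (simp add: reduce_def matrix_transpose_mul matrix_mul_assoc)
  also have "\<dots> = - Jmat Hr"
    using pH' by (simp add: reduce_def vec_eq_iff matrix_matrix_mult_def sum_negf)
  finally have "transpose (Jmat Hr) = - Jmat Hr" .
  moreover have "transpose (Rmat Hr) = Rmat Hr"
    using pH' by (simp add: reduce_def matrix_transpose_mul matrix_mul_assoc)
  moreover have "0 \<le> v \<bullet> (Rmat Hr *v v)" for v
    using pH' by (simp add: reduce_def inner_transpose_conjugation)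
  ultimately show ?thesis
    unfolding port_hamiltonian_def using reduce_Q_symmetric reduce_Q_pos by blast
qed

text \<open>This cancellation turns the two-sided compressions by \<open>W\<close> into the
  projected forms of the state and output matrices.\<close>

lemma W_mult_reduce_Q: "W ** Qmat Hr = Qmat G ** V"
proof -
  have "W = Qmat G ** V ** matrix_inv (Qmat Hr)"
    by (simp add: what_def reduce_def)
  then show ?thesis
    by (metis matrix_mul_assoc matrix_inv_left reduce_Q_invertible matrix_mul_rid)
qed

lemma transpose_W_mult_V: "transpose W ** V = mat 1"
proof -
  have "W = Qmat G ** V ** matrix_inv (Qmat Hr)"
    by (simp add: what_def reduce_def)
  then have "transpose W = matrix_inv (Qmat Hr) ** (transpose V ** Qmat G)"
    using pH unfolding port_hamiltonian_def
    by (simp add: matrix_transpose_mul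
        transpose_matrix_inv_symmetric[OF reduce_Q_invertible reduce_Q_symmetric])
  moreover have "transpose V ** Qmat G ** V = Qmat Hr"
    by (simp add: reduce_def)
  ultimately have "transpose W ** V = matrix_inv (Qmat Hr) ** Qmat Hr"
    by (simp add: matrix_mul_assoc[symmetric])
  then show ?thesis
    using matrix_inv_left[OF reduce_Q_invertible] by simp
qed

lemma Amat_reduce: "Amat Hr = transpose W ** Amat G ** V"
proof -
  have "Jmat Hr - Rmat Hr = transpose W ** (Jmat G - Rmat G) ** W"
    by (simp add: reduce_def vec_eq_iff matrix_matrix_mult_def sum_subtractf algebra_simps)
  then have "Amat Hr = transpose W ** (Jmat G - Rmat G) ** (W ** Qmat Hr)"
    by (simp add: Amat_def matrix_mul_assoc)
  then show ?thesis
    by (simp add: W_mult_reduce_Q Amat_def matrix_mul_assoc)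
qed

lemma Bmat_reduce: "Bmat Hr = transpose W ** Bmat G"
  by (simp add: reduce_def)

lemma Cmat_reduce: "Cmat Hr = Cmat G ** V"
proof -
  have "Cmat Hr = transpose (Bmat G) ** (W ** Qmat Hr)"
    by (simp add: Cmat_def Bmat_reduce matrix_transpose_mul matrix_mul_assoc)
  then show ?thesis
    by (simp add: W_mult_reduce_Q Cmat_def matrix_mul_assoc)
qed

text \<open>Multiply by \<open>W\<^sup>T\<close> and use \<open>W\<^sup>T V = I\<close>. A linear
  equation instead of resolvents lets this be applied even at an eigenvalue of the reduced state
  matrix.\<close>

lemma Petrov_Galerkin_projection:
  assumes "(mat z - cmat (Amat G)) *v (cmat V *v \<xi>) = cmat (Bmat G) *v b"
  shows "(mat z - cmat (Amat Hr)) *v \<xi> = cmat (Bmat Hr) *v b"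
proof -
  have "cmat (transpose W) *v ((mat z - cmat (Amat G)) *v (cmat V *v \<xi>)) =
      z *s (cmat (transpose W ** V) *v \<xi>) - cmat (transpose W ** Amat G ** V) *v \<xi>"
    by (simp only: matrix_vector_mult_diff_rdistrib matrix_vector_mult_diff_distrib mat_mult_vec
        vector_scalar_commute cmat_mult flip: matrix_vector_mul_assoc)
  also have "\<dots> = (mat z - cmat (Amat Hr)) *v \<xi>"
    by (simp only: transpose_W_mult_V cmat_mat_1 Amat_reduce matrix_vector_mult_diff_rdistrib
        mat_mult_vec vector_smult_lid)
  finally show ?thesis
    by (simp add: assms Bmat_reduce cmat_mult flip: matrix_vector_mul_assoc)
qed

text \<open>The full state is \<open>V \<xi>\<close> and the reduced state is \<open>\<xi>\<close>,
  so \<open>C\<^sub>r = C V\<close> makes the outputs agree.\<close>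

lemma tangential_interpolation:
  assumes "(mat z - cmat (Amat G)) *v (cmat V *v \<xi>) = cmat (Bmat G) *v b"
    and "invertible (mat z - cmat (Amat G))" "invertible (mat z - cmat (Amat Hr))"
  shows "transfer G z *v b = transfer Hr z *v b"
proof -
  have "matrix_inv (mat z - cmat (Amat G)) *v (cmat (Bmat G) *v b) = cmat V *v \<xi>"
    using matrix_inv_left[OF assms(2)]
    by (simp add: assms(1)[symmetric] matrix_vector_mul_assoc matrix_mul_assoc)
  moreover have "matrix_inv (mat z - cmat (Amat Hr)) *v (cmat (Bmat Hr) *v b) = \<xi>"
    using matrix_inv_left[OF assms(3)]
    by (simp add: Petrov_Galerkin_projection[OF assms(1), symmetric] matrix_vector_mul_assoc)
  ultimately show ?thesis
    by (simp add: transfer_def Cmat_reduce cmat_mult matrix_vector_mul_assoc[symmetric])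
qed

end


section \<open>Eigensystems\<close>

lemma eigensystem_expansion:
  assumes "eigensystem A lam x y"
  shows "w = (\<Sum>i\<in>UNIV. scalar_product (cnj_vec (y i)) w *s x i)"
proof -
  define X where "X = (\<chi> k i. x i $ k)"
  define Y where "Y = (\<chi> i k. cnj_vec (y i) $ k)"
  have "Y ** X = mat 1"
    using assms by (simp add: eigensystem_def X_def Y_def vec_eq_iff matrix_matrix_mult_def
        mat_def scalar_product_def)
  \<comment> \<open>Biorthonormality is \<open>Y X = I\<close>; for square matrices it gives
    \<open>X Y = I\<close>.\<close>
  then have "w = X *v (Y *v w)"
    by (simp add: matrix_vector_mul_assoc matrix_left_right_inverse)
  also have "\<dots> = (\<Sum>i\<in>UNIV. scalar_product (cnj_vec (y i)) w *s x i)"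
    by (simp add: X_def Y_def vec_eq_iff matrix_vector_mult_def scalar_product_def mult.commute)
  finally show ?thesis .
qed

text \<open>Some coefficient \<open>y\<^sub>i\<^sup>* v\<close> of the eigenvector is nonzero;
  evaluating \<open>y\<^sub>i\<^sup>* A v\<close> from both sides forces the eigenvalues to
  agree.\<close>

lemma eigensystem_eigenvalue:
  assumes "eigensystem A lam x y" "eigenvalue A \<mu>"
  obtains i where "\<mu> = lam i"
proof -
  obtain v where v: "v \<noteq> 0" "A *v v = \<mu> *s v"
    using assms(2) by (auto simp: eigenvalue_def)
  obtain i where i: "scalar_product (cnj_vec (y i)) v \<noteq> 0"
    using eigensystem_expansion[OF assms(1), of v] v(1) by (force intro: sum.neutral)
  have "\<mu> * scalar_product (cnj_vec (y i)) v = scalar_product (cnj_vec (y i)) (A *v v)"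
    by (simp add: v(2) scalar_product_def sum_distrib_left mult_ac)
  also have "\<dots> = lam i * scalar_product (cnj_vec (y i)) v"
    using assms(1) unfolding scalar_product_matrix_vector eigensystem_def
    by (simp add: scalar_product_def sum_distrib_left mult_ac)
  finally show ?thesis
    using i that by simp
qed

text \<open>In the eigenbasis \<open>z I - A\<close> is diagonal with entries
  \<open>z - lam i\<close>, so its inverse divides the coefficients by them.\<close>

lemma eigensystem_resolvent:
  assumes "eigensystem A lam x y" "\<And>i. z \<noteq> lam i"
  shows "invertible (mat z - A)"
    and "matrix_inv (mat z - A) *v w =
      (\<Sum>i\<in>UNIV. (1 / (z - lam i) * scalar_product (cnj_vec (y i)) w) *s x i)"
proof -
  show inv: "invertible (mat z - A)"
  proof (rule invertible_of_ker, rule ccontr)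
    fix v assume "(mat z - A) *v v = 0" "v \<noteq> 0"
    then have "eigenvalue A z"
      unfolding eigenvalue_def by (intro exI[of _ v]) (simp add: matrix_vector_mult_diff_rdistrib mat_mult_vec)
    then show False
      using eigensystem_eigenvalue assms by metis
  qed
  let ?c = "\<lambda>i. scalar_product (cnj_vec (y i)) w"
  have "(mat z - A) *v (\<Sum>i\<in>UNIV. (1 / (z - lam i) * ?c i) *s x i) = (\<Sum>i\<in>UNIV. ?c i *s x i)"
    unfolding matrix_vector_mult_sum
  proof (rule sum.cong[OF refl])
    fix i
    have "A *v x i = lam i *s x i"
      using assms(1) by (simp add: eigensystem_def)
    then show "(mat z - A) *v ((1 / (z - lam i) * ?c i) *s x i) = ?c i *s x i"
      using assms(2)[of i]
      by (simp add: matrix_vector_mult_diff_rdistrib mat_mult_vec vector_scalar_commute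
          vec_eq_iff divide_simps) (simp add: algebra_simps)
  qed
  also have "\<dots> = w"
    by (rule eigensystem_expansion[OF assms(1), symmetric])
  finally have "matrix_inv (mat z - A) *v w =
      (matrix_inv (mat z - A) ** (mat z - A)) *v (\<Sum>i\<in>UNIV. (1 / (z - lam i) * ?c i) *s x i)"
    by (simp flip: matrix_vector_mul_assoc)
  then show "matrix_inv (mat z - A) *v w = (\<Sum>i\<in>UNIV. (1 / (z - lam i) * ?c i) *s x i)"
    by (simp only: matrix_inv_left[OF inv] matrix_vector_mul_lid)
qed

text \<open>Expand the resolvent in the eigenbasis and compare the action on an arbitrary
  \<open>w\<close>; each pole contributes a rank-one residue.\<close>

lemma transfer_pole_residue:
  assumes "eigensystem (cmat (Amat G)) lam x y" "\<And>i. z \<noteq> lam i"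
  shows "transfer G z = (\<chi> j k. \<Sum>i\<in>UNIV. 1 / (z - lam i) * (cmat (Cmat G) *v x i) $ j *
      (cnj_vec (y i) v* cmat (Bmat G)) $ k)"
    (is "_ = ?S")
proof -
  let ?b = "\<lambda>i. cnj_vec (y i) v* cmat (Bmat G)"
  have "transfer G z *v w = ?S *v w" for w
  proof -
    have "transfer G z *v w = cmat (Cmat G) *v
        (\<Sum>i\<in>UNIV. (1 / (z - lam i) * scalar_product (cnj_vec (y i)) (cmat (Bmat G) *v w)) *s x i)"
      by (simp only: transfer_def matrix_vector_mul_assoc[symmetric] eigensystem_resolvent(2)[OF assms])
    also have "\<dots> = (\<Sum>i\<in>UNIV. (1 / (z - lam i) * scalar_product (?b i) w) *s (cmat (Cmat G) *v x i))"
      by (simp add: matrix_vector_mult_sum vector_scalar_commute scalar_product_matrix_vector)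
    also have "\<dots> = ?S *v w"
    proof (subst vec_eq_iff, rule allI)
      fix j
      have "(\<Sum>i\<in>UNIV. (1 / (z - lam i) * scalar_product (?b i) w) *s (cmat (Cmat G) *v x i)) $ j
        = (\<Sum>i\<in>UNIV. \<Sum>k\<in>UNIV. 1 / (z - lam i) * (cmat (Cmat G) *v x i) $ j * ?b i $ k * w $ k)"
        by (simp add: scalar_product_def sum_distrib_left sum_distrib_right mult_ac)
      also have "\<dots> = (?S *v w) $ j"
        by (subst sum.swap) (simp only: matrix_vector_mult_def[of ?S] vec_lambda_beta sum_distrib_right)
      finally show "(\<Sum>i\<in>UNIV. (1 / (z - lam i) * scalar_product (?b i) w) *s (cmat (Cmat G) *v x i)) $ j
        = (?S *v w) $ j" .
    qed
    finally show ?thesis .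
  qed
  then show ?thesis
    by (simp add: matrix_eq)
qed


section \<open>Fixed points of the iteration\<close>

lemma column_krylov_basis:
  "column i (krylov_basis G s b) =
    matrix_inv (mat (s i) - cmat (Amat G)) *v (cmat (Bmat G) *v b i)"
  by (simp add: krylov_basis_def column_def vec_eq_iff)

theorem theorem11:
  fixes G :: "('n::finite, 'm::finite) sys"
    and Gr :: "('r::finite, 'm) sys"
    and s lam :: "'r \<Rightarrow> complex"
    and b :: "'r \<Rightarrow> complex^'m"
    and x y :: "'r \<Rightarrow> complex^'r"
  assumes "port_hamiltonian G"
    and "asymptotically_stable G"
    and "irka_ph_converges G s b Gr lam x y"
  shows "(\<forall>z. (\<forall>i. z \<noteq> lam i) \<longrightarrow>
            transfer Gr z =
              (\<chi> j k. \<Sum>i\<in>UNIV. 1 / (z - lam i) * (cmat (Cmat Gr) *v x i) $ j * b i $ k)) \<and>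
         port_hamiltonian Gr \<and> asymptotically_stable Gr \<and> is_passive Gr \<and>
         (\<forall>i. transfer G (- lam i) *v b i = transfer Gr (- lam i) *v b i)"
proof -
  have red: "reduced_model G s b Gr" and eig: "eigensystem (cmat (Amat Gr)) lam x y"
    and s: "\<And>i. s i = - lam i" and b: "\<And>i. b i = cnj_vec (y i) v* cmat (Bmat Gr)"
    using assms(3) by (simp_all add: irka_ph_converges_def irka_ph_step_def)
  define K where "K = krylov_basis G s b"
  obtain M V where M: "invertible M" and VM: "cmat V = K ** M" and Gr: "Gr = reduce G V"
    using red unfolding reduced_model_def K_def by blast
  have rank: "rank K = CARD('r)" and s_inv: "\<And>i. invertible (mat (s i) - cmat (Amat G))"
    and cc: "conj_closed s b"
    using red by (simp_all add: reduced_model_def K_def)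

  \<comment> \<open>Over the complex numbers \<open>V = K M\<close>, where \<open>K\<close> has full
    column rank and \<open>M\<close> is invertible.\<close>
  have "v = 0" if "V *v v = 0" for v
  proof -
    have "cmat V *v (\<chi> k. complex_of_real (v $ k)) = (\<chi> k. complex_of_real ((V *v v) $ k))"
      by (simp add: vec_eq_iff matrix_vector_mult_def)
    then have "K *v (M *v (\<chi> k. complex_of_real (v $ k))) = 0"
      using that by (simp add: VM matrix_vector_mul_assoc vec_eq_iff)
    then have "M *v (\<chi> k. complex_of_real (v $ k)) = 0"
      using full_column_rank_ker[OF rank] by blast
    then have "(\<chi> k. complex_of_real (v $ k)) = 0"
      using M by (metis matrix_inv_left matrix_vector_mul_assoc matrix_vector_mul_lid
          matrix_vector_mult_0_right)
    then show ?thesis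
      by (simp add: vec_eq_iff)
  qed
  with assms(1) interpret ph_reduction G V
    by unfold_locales
  have pHr: "port_hamiltonian Gr"
    using port_hamiltonian_reduce Gr by simp

  \<comment> \<open>These are the coordinates of the \<open>i\<close>-th Krylov vector in the
    columns of \<open>V\<close>, since \<open>K = V M\<^sup>-\<^sup>1\<close>.\<close>
  define \<xi> where "\<xi> i = matrix_inv M *v axis i 1" for i
  have "cmat V *v \<xi> i = column i K" for i
    unfolding VM \<xi>_def matrix_vector_mul_assoc matrix_mul_assoc[symmetric] matrix_inv_right[OF M]
    by (simp add: matrix_vector_mult_axis)
  then have \<xi>: "(mat (s i) - cmat (Amat G)) *v (cmat V *v \<xi> i) = cmat (Bmat G) *v b i" for i
    using matrix_inv_right[OF s_inv[of i]]
    by (simp add: K_def column_krylov_basis matrix_vector_mul_assoc matrix_mul_assoc)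

  have b_nz: "b i \<noteq> 0" for i
  proof
    assume "b i = 0"
    then have "K *v axis i 1 = 0"
      by (simp add: K_def column_krylov_basis matrix_vector_mult_axis)
    then show False
      using full_column_rank_ker[OF rank] by fastforce
  qed

  have Re_lam: "Re (lam i) < 0" for i
  proof -
    have x: "cmat (Amat Gr) *v x i = lam i *s x i"
      and y: "\<And>k. cnj_vec (y k) v* cmat (Amat Gr) = lam k *s cnj_vec (y k)"
      using eig by (simp_all add: eigensystem_def)
    have "scalar_product (cnj_vec (y i)) (x i) = 1"
      using eig by (simp add: eigensystem_def)
    then have "x i \<noteq> 0"
      by (auto simp: scalar_product_def)
    then have "Re (lam i) \<le> 0"
      using port_hamiltonian_eigenvalue_Re_le_0[OF pHr x] by blast
    moreover have "Re (lam i) \<noteq> 0"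
    proof
      assume Re0: "Re (lam i) = 0"
      obtain k where "s k = cnj (s i)" and bk: "b k = cnj_vec (b i)"
        using cc unfolding conj_closed_def by blast
      \<comment> \<open>Reflection in the imaginary axis, \<open>- cnj (s i)\<close>, fixes the
        purely imaginary point \<open>s i\<close>.\<close>
      then have lk: "lam k = s i"
        using Re0 by (simp add: s complex_eq_iff)
      have "scalar_product (b k) (b i) = scalar_product (cnj_vec (y k)) (cmat (Bmat Gr) *v b i)"
        by (simp add: scalar_product_matrix_vector b[of k])
      also have "\<dots> = scalar_product (cnj_vec (y k)) ((mat (s i) - cmat (Amat Gr)) *v \<xi> i)"
        by (simp add: Petrov_Galerkin_projection[OF \<xi>] Gr)
      also have "\<dots> = scalar_product (cnj_vec (y k) v* (mat (s i) - cmat (Amat Gr))) (\<xi> i)"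
        by (rule scalar_product_matrix_vector)
      also have "cnj_vec (y k) v* (mat (s i) - cmat (Amat Gr)) = 0"
        by (simp add: vector_matrix_mult_diff_rdistrib y lk vec_mult_mat)
      also have "scalar_product 0 (\<xi> i) = 0"
        by (simp add: scalar_product_def)
      finally show False
        using scalar_product_cnj_vec_self_eq_0 b_nz by (metis bk)
    qed
    ultimately show ?thesis
      by simp
  qed

  have "asymptotically_stable Gr"
    using Re_lam eigensystem_eigenvalue[OF eig] unfolding asymptotically_stable_def by metis
  moreover have "transfer G (- lam i) *v b i = transfer Gr (- lam i) *v b i" for i
  proof -
    \<comment> \<open>The two points lie on opposite sides of the imaginary axis.\<close>
    have "s i \<noteq> lam j" for j
      using Re_lam[of i] Re_lam[of j] by (auto simp: s complex_eq_iff)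
    then have "invertible (mat (s i) - cmat (Amat Gr))"
      using eigensystem_resolvent(1)[OF eig] by blast
    then show ?thesis
      using tangential_interpolation[OF \<xi> s_inv] by (simp add: Gr s)
  qed
  moreover have "transfer Gr z =
      (\<chi> j k. \<Sum>i\<in>UNIV. 1 / (z - lam i) * (cmat (Cmat Gr) *v x i) $ j * b i $ k)"
    if "\<forall>i. z \<noteq> lam i" for z
    using transfer_pole_residue[OF eig, of z] that by (simp add: b[symmetric])
  ultimately show ?thesis
    using pHr port_hamiltonian_is_passive[OF pHr] by blast
qed

end
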